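(* Let $B$ be a skew brace with property (S). Then $B$ is a subdirect product of a trivial brace $C$ and a periodic skew brace $D$. Moreover, $C$ and $D$ are homomorphic images of $B$.
   Context: A skew (left) brace is a triple $(B,+,\circ)$ where $(B,+)$ and $(B,\circ)$ are (not necessarily abelian) groups such that $a\circ(b+c)=a\circ b-a+a\circ c$ for all $a,b,c\in B$. The two identities coincide and are denoted $0$. Put $\lambda_a(b)=-a+a\circ b$ and $a\ast b=\lambda_a(b)-b=-a+a\circ b-b$. A trivial brace is a skew brace in which $(B,+)$ is abelian and $a\circ b=a+b$ for all $a,b$. For $x\in B$ let $\operatorname{Fix}^r(x)=\{b\in B: x\ast b=0\}$ (a subgroup of $(B,+)$), $\operatorname{Fix}^l(x)=\{b\in B: b\ast x=0\}$ (a subgroup of $(B,\circ)$), and let $C_x^+$, $C_x^\circ$ be the centralisers of $x$ in $(B,+)$ and $(B,\circ)$. An element $x$ has property (s) if the indices $|(B,+):\operatorname{Fix}^r(x)\cap C_x^+|$ and $|(B,\circ):\operatorname{Fix}^l(x)\cap C_x^\circ|$ are both finite. $B$ has property (S) if all its elements have property (s). A periodic skew brace is a skew brace with property (S) in which every element of $(B,+)$ has finite order. $B$ is a subdirect product of $C$ and $D$ if $B$ is isomorphic to a sub-skew brace (a subset that is a subgroup for both operations) of the direct product $C\times D$ that projects onto both factors. *)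

theory Defs
  imports "HOL-Algebra.Algebra"
begin

text \<open>
  A skew brace is carried by the record type of rings, which provides exactly the two
  operations needed: \<open>\<oplus>\<close> is the (not necessarily commutative) group operation written
  \<open>+\<close> in the literature and \<open>\<otimes>\<close> is the one written \<open>\<circ>\<close>. No ring axioms are assumed.
  The record has two fields \<open>\<zero>\<close> and \<open>\<one>\<close> for the two identities; that they
  coincide is a consequence of the axioms (\<open>zero_eq_one\<close> below).
  Homomorphisms and isomorphisms of skew braces are those of the library for this record type,
  \<^const>\<open>ring_hom\<close> and \<^const>\<open>is_ring_iso\<close>, and direct products are \<^const>\<open>RDirProd\<close>; none of
  these definitions refers to the ring axioms.
\<close>

locale skew_brace = group B for B :: "('a, 'm) ring_scheme" (structure) +
  assumes add_group: "group (add_monoid B)"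
    and brace_distrib:
      "\<lbrakk>a \<in> carrier B; b \<in> carrier B; c \<in> carrier B\<rbrakk>
        \<Longrightarrow> a \<otimes> (b \<oplus> c) = a \<otimes> b \<ominus> a \<oplus> a \<otimes> c"

lemma (in skew_brace) zero_eq_one: "\<zero> = \<one>"
proof -
  interpret A: group "add_monoid B" by (rule add_group)
  have z: "\<zero> \<in> carrier B" using A.one_closed by simp
  have o: "\<one> \<in> carrier B" by simp
  have "\<one> \<otimes> (\<zero> \<oplus> \<zero>) = \<one> \<otimes> \<zero> \<ominus> \<one> \<oplus> \<one> \<otimes> \<zero>"
    by (rule brace_distrib[OF o z z])
  moreover have "\<zero> \<oplus> \<zero> = \<zero>" using A.l_one[of "\<zero>"] z by simp
  ultimately have "\<zero> = \<zero> \<ominus> \<one> \<oplus> \<zero>" using z by simp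
  moreover have inv: "\<ominus> \<one> \<in> carrier B" using A.inv_closed[of "\<one>"] o by (simp add: a_inv_def)
  ultimately have "\<ominus> \<one> = \<zero>"
    using A.l_one[of "\<ominus> \<one>"] A.r_one[of "\<ominus> \<one>"] by (simp add: a_minus_def)
  then show ?thesis using A.inv_eq_1_iff[of "\<one>"] o by (simp add: a_inv_def)
qed

definition trivial_brace :: "('a, 'm) ring_scheme \<Rightarrow> bool" where
  "trivial_brace B \<longleftrightarrow> skew_brace B \<and> comm_group (add_monoid B) \<and>
    (\<forall>a\<in>carrier B. \<forall>b\<in>carrier B. a \<otimes>\<^bsub>B\<^esub> b = a \<oplus>\<^bsub>B\<^esub> b)"

definition brace_lambda :: "('a, 'm) ring_scheme \<Rightarrow> 'a \<Rightarrow> 'a \<Rightarrow> 'a" where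
  "brace_lambda B a b = \<ominus>\<^bsub>B\<^esub> a \<oplus>\<^bsub>B\<^esub> a \<otimes>\<^bsub>B\<^esub> b"

definition brace_star :: "('a, 'm) ring_scheme \<Rightarrow> 'a \<Rightarrow> 'a \<Rightarrow> 'a" where
  "brace_star B a b = brace_lambda B a b \<ominus>\<^bsub>B\<^esub> b"

definition Fix_r :: "('a, 'm) ring_scheme \<Rightarrow> 'a \<Rightarrow> 'a set" where
  "Fix_r B x = {b \<in> carrier B. brace_star B x b = \<zero>\<^bsub>B\<^esub>}"

definition Fix_l :: "('a, 'm) ring_scheme \<Rightarrow> 'a \<Rightarrow> 'a set" where
  "Fix_l B x = {b \<in> carrier B. brace_star B b x = \<zero>\<^bsub>B\<^esub>}"

definition centraliser :: "('a, 'm) monoid_scheme \<Rightarrow> 'a \<Rightarrow> 'a set" where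
  "centraliser G x = {b \<in> carrier G. b \<otimes>\<^bsub>G\<^esub> x = x \<otimes>\<^bsub>G\<^esub> b}"

text \<open>
  The index of a subgroup is finite if its set of right cosets is.
\<close>

definition property_s :: "('a, 'm) ring_scheme \<Rightarrow> 'a \<Rightarrow> bool" where
  "property_s B x \<longleftrightarrow>
    finite (rcosets\<^bsub>add_monoid B\<^esub> (Fix_r B x \<inter> centraliser (add_monoid B) x)) \<and>
    finite (rcosets\<^bsub>B\<^esub> (Fix_l B x \<inter> centraliser B x))"

definition property_S :: "('a, 'm) ring_scheme \<Rightarrow> bool" where
  "property_S B \<longleftrightarrow> (\<forall>x\<in>carrier B. property_s B x)"

definition periodic_skew_brace :: "('a, 'm) ring_scheme \<Rightarrow> bool" where
  "periodic_skew_brace B \<longleftrightarrow> skew_brace B \<and> property_S B \<and>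
    (\<forall>x\<in>carrier B. \<exists>n::nat. n > 0 \<and> [n] \<cdot>\<^bsub>B\<^esub> x = \<zero>\<^bsub>B\<^esub>)"

definition sub_skew_brace :: "'a set \<Rightarrow> ('a, 'm) ring_scheme \<Rightarrow> bool" where
  "sub_skew_brace S B \<longleftrightarrow> subgroup S (add_monoid B) \<and> subgroup S B"

definition subdirect_product ::
  "('a, 'm) ring_scheme \<Rightarrow> ('b, 'n) ring_scheme \<Rightarrow> ('c, 'k) ring_scheme \<Rightarrow> bool" where
  "subdirect_product B C D \<longleftrightarrow>
    (\<exists>S. sub_skew_brace S (RDirProd C D) \<and>
         fst ` S = carrier C \<and> snd ` S = carrier D \<and>
         B \<simeq> (RDirProd C D)\<lparr>carrier := S\<rparr>)"

definition homomorphic_image :: "('a, 'm) ring_scheme \<Rightarrow> ('b, 'n) ring_scheme \<Rightarrow> bool" where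
  "homomorphic_image C B \<longleftrightarrow> (\<exists>h\<in>ring_hom B C. h ` carrier B = carrier C)"

end

theory Submission
  imports Defs
begin

text \<open>
  The proof generalises the classical fact that an FC-group, that is a group all of whose elements have
  a centraliser of finite index, is a subdirect product of an abelian group and a periodic group. Two
  ideals with trivial intersection are found, one with a trivial brace as quotient and the other
  with a periodic one; the quotient maps then embed \<open>B\<close> into the product of the two quotients.

  The first ideal is the set \<open>T\<close> of elements of finite additive order. By property (S) the additive
  group is an FC-group. In an FC-group the torsion elements form a normal subgroup that contains all
  commutators and all \<open>x \<otimes> inv y\<close> for elements \<open>x\<close>, \<open>y\<close> with a common positive power
  (\<open>FC_torsion\<close>); this is obtained by a transfer argument. Some positive multiple of \<open>b\<close> is fixed by
  \<open>\<lambda>\<^sub>a\<close>, so \<open>b\<close> and \<open>\<lambda>\<^sub>a(b)\<close> have a common positive multiple and \<open>a \<ast> b\<close> lies in \<open>T\<close>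
  (\<open>star_torsion\<close>). Hence modulo \<open>T\<close> the additive group is abelian and both operations agree.

  The second ideal is a subgroup \<open>Z\<close> of the annihilator, the set of elements that are central for both
  operations and act trivially on either side of \<open>\<ast>\<close>. Every additive subgroup of the annihilator is an
  ideal. Let \<open>Z\<close> be maximal among those that meet \<open>T\<close> trivially. By maximality each element of the
  annihilator has a positive multiple in \<open>Z\<close> (\<open>maximal_torsion_free_annihilating_subgroup\<close>), and by
  property (S) each element of \<open>B\<close> has a positive multiple in the annihilator
  (\<open>multiple_in_annihilator\<close>), so the quotient by \<open>Z\<close> is periodic; it inherits property (S) as a
  homomorphic image.
\<close>

section \<open>Subgroups of finite index\<close>

lemma finite_image_if_determined:
  assumes "finite (f ` A)"
    and determined: "\<And>x y. x \<in> A \<Longrightarrow> y \<in> A \<Longrightarrow> f x = f y \<Longrightarrow> g x = g y"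
  shows "finite (g ` A)"
proof -
  have "g x = g (inv_into A f (f x))" if "x \<in> A" for x
    using determined[of x "inv_into A f (f x)"] that by (simp add: f_inv_into_f inv_into_into)
  then have "g ` A \<subseteq> (\<lambda>c. g (inv_into A f c)) ` f ` A"
    by (auto simp: image_image)
  then show ?thesis using assms(1) finite_surj by blast
qed

context group begin

text \<open>
  Finite index is used below only through finite transversals: a property that is inherited by
  products holds on the whole group as soon as it holds on a subgroup of finite index and on the
  finitely many elements of a transversal.
\<close>

lemma finite_index_transversal:
  assumes "subgroup H G" and "finite (rcosets H)"
  obtains Y where "finite Y" "Y \<subseteq> carrier G"
    "\<And>g. g \<in> carrier G \<Longrightarrow> \<exists>y\<in>Y. \<exists>h\<in>H. g = h \<otimes> y"
proof -
  have eq: "rcosets H = (\<lambda>a. H #> a) ` carrier G"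
    by (auto simp: RCOSETS_def)
  from finite_subset_image[OF assms(2), of "\<lambda>a. H #> a" "carrier G"] eq
  obtain Y where Y: "Y \<subseteq> carrier G" "finite Y" "rcosets H = (\<lambda>a. H #> a) ` Y"
    by auto
  have "\<exists>y\<in>Y. \<exists>h\<in>H. g = h \<otimes> y" if g: "g \<in> carrier G" for g
  proof -
    have "H #> g \<in> (\<lambda>a. H #> a) ` Y" using Y(3) eq g by blast
    then obtain y where y: "y \<in> Y" "H #> g = H #> y" by auto
    have "g \<in> H #> y" using rcos_self[OF g assms(1)] y by simp
    then show ?thesis using y by (auto simp: r_coset_def)
  qed
  then show ?thesis using that Y by blast
qed

lemma finite_index_if_transversal:
  assumes H: "subgroup H G" and "finite Y" and "Y \<subseteq> carrier G"
    and "\<And>g. g \<in> carrier G \<Longrightarrow> \<exists>y\<in>Y. \<exists>h\<in>H. g = h \<otimes> y"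
  shows "finite (rcosets H)"
proof -
  have "H #> g \<in> (\<lambda>a. H #> a) ` Y" if "g \<in> carrier G" for g
  proof -
    obtain y h where yh: "y \<in> Y" "h \<in> H" "g = h \<otimes> y" using assms(4) \<open>g \<in> carrier G\<close> by blast
    have "g \<in> H #> y" using yh by (auto simp: r_coset_def)
    then have "H #> y = H #> g" using repr_independence[OF _ _ H] yh assms(3) by blast
    then show ?thesis using yh by blast
  qed
  then have "rcosets H \<subseteq> (\<lambda>a. H #> a) ` Y" by (auto simp: RCOSETS_def)
  then show ?thesis using assms(2) finite_surj by blast
qed

lemma finite_index_mono:
  assumes "subgroup H G" "subgroup K G" "H \<subseteq> K" "finite (rcosets H)"
  shows "finite (rcosets K)"
proof -
  obtain Y where Y: "finite Y" "Y \<subseteq> carrier G"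
    "\<And>g. g \<in> carrier G \<Longrightarrow> \<exists>y\<in>Y. \<exists>h\<in>H. g = h \<otimes> y"
    using finite_index_transversal[OF assms(1,4)] by blast
  show ?thesis
    by (rule finite_index_if_transversal[OF assms(2) Y(1,2)]) (use Y(3) assms(3) in blast)
qed

lemma r_coset_eqD:
  assumes "subgroup H G" "x \<in> carrier G" "y \<in> carrier G" "H #> x = H #> y"
  shows "x \<otimes> inv y \<in> H"
proof -
  have "x \<in> H #> y" using rcos_self[OF assms(2,1)] assms(4) by simp
  then obtain h where h: "h \<in> H" "x = h \<otimes> y" by (auto simp: r_coset_def)
  then have "x \<otimes> inv y = h"
    using assms subgroup.mem_carrier[OF assms(1)] by (simp add: m_assoc)
  then show ?thesis using h by simp
qed

lemma r_coset_eqI: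
  assumes "subgroup H G" "x \<in> carrier G" "y \<in> carrier G" "x \<otimes> inv y \<in> H"
  shows "H #> x = H #> y"
proof -
  have "x = (x \<otimes> inv y) \<otimes> y" using assms by (simp add: m_assoc)
  then have "x \<in> H #> y" using assms(4) by (auto simp: r_coset_def)
  then show ?thesis using repr_independence[OF _ assms(3,1)] by simp
qed

text \<open>
  By the pigeonhole principle two different powers of \<open>x\<close> lie in the same coset, and their quotient
  is again a power of \<open>x\<close>.
\<close>

lemma finite_index_pow_mem:
  assumes H: "subgroup H G" and fin: "finite (rcosets H)" and x: "x \<in> carrier G"
  obtains n :: nat where "n > 0" "x [^] n \<in> H"
proof -
  have "(\<lambda>n::nat. H #> (x [^] n)) ` UNIV \<subseteq> rcosets H"
    using x by (auto simp: RCOSETS_def)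
  then have "\<not> inj (\<lambda>n::nat. H #> (x [^] n))"
    using fin finite_imageD finite_subset infinite_UNIV_nat by blast
  then obtain a b :: nat where "a \<noteq> b" "H #> (x [^] a) = H #> (x [^] b)"
    by (auto simp: inj_def)
  then obtain m n :: nat where mn: "m < n" "H #> (x [^] n) = H #> (x [^] m)"
    by (metis linorder_neqE_nat)
  have "x [^] n \<otimes> inv (x [^] m) \<in> H" using r_coset_eqD[OF H _ _ mn(2)] x by simp
  moreover have "x [^] n = x [^] (n - m) \<otimes> x [^] m" using mn(1) x by (simp add: nat_pow_mult)
  ultimately have "x [^] (n - m) \<in> H" using x by (simp add: m_assoc)
  then show ?thesis using that[of "n - m"] mn(1) by simp
qed

lemma subgroup_nat_pow_mem:
  assumes "subgroup H G" "x \<in> H"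
  shows "x [^] (n::nat) \<in> H"
  using assms by (induction n) (auto intro: subgroup.m_closed subgroup.one_closed)

text \<open>
  One exponent serves finitely many subgroups: a power of \<open>x\<close> that lies in some of them can be
  raised to a further power that also lies in the next one.
\<close>

lemma finite_index_common_pow_mem:
  assumes "finite Y" and "\<And>y. y \<in> Y \<Longrightarrow> subgroup (H y) G"
    and "\<And>y. y \<in> Y \<Longrightarrow> finite (rcosets (H y))" and x: "x \<in> carrier G"
  shows "\<exists>n::nat. n > 0 \<and> (\<forall>y\<in>Y. x [^] n \<in> H y)"
  using assms
proof (induction Y)
  case empty
  then show ?case by auto
next
  case (insert y Y)
  then obtain n :: nat where n: "n > 0" "\<forall>y\<in>Y. x [^] n \<in> H y" by auto
  obtain m :: nat where m: "m > 0" "(x [^] n) [^] m \<in> H y"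
    using finite_index_pow_mem[of "H y" "x [^] n"] insert by auto
  have "(x [^] n) [^] m \<in> H z" if "z \<in> Y" for z
    using subgroup_nat_pow_mem[of "H z" "x [^] n"] n(2) that insert.prems(1) by simp
  then have "\<forall>z\<in>insert y Y. x [^] (n * m) \<in> H z"
    using m(2) x by (simp add: nat_pow_pow)
  then show ?case using n(1) m(1) by (intro exI[of _ "n * m"]) simp
qed


section \<open>Torsion in FC-groups\<close>

text \<open>
  The map \<open>V\<close> is the transfer from \<open>G\<close> to \<open>Z\<close>. For a choice of representatives \<open>s q\<close> of the cosets \<open>q\<close>,
  the elements \<open>s q \<otimes> g \<otimes> inv (s (q #> g))\<close> of \<open>Z\<close> measure how far \<open>s\<close> is from being equivariant under
  right multiplication. They form a cocycle, and right multiplication permutes the cosets, so their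
  product over all cosets is multiplicative in \<open>g\<close>. A central element \<open>z\<close> fixes every coset and
  contributes the factor \<open>z\<close> each time, hence it is sent to its power by the index of \<open>Z\<close>.
\<close>

lemma transfer_to_central_subgroup:
  assumes Z: "subgroup Z G" and central: "\<And>z g. z \<in> Z \<Longrightarrow> g \<in> carrier G \<Longrightarrow> z \<otimes> g = g \<otimes> z"
    and fin: "finite (rcosets Z)"
  obtains V and n :: nat where "n > 0" "\<And>g. g \<in> carrier G \<Longrightarrow> V g \<in> Z"
    "\<And>g h. g \<in> carrier G \<Longrightarrow> h \<in> carrier G \<Longrightarrow> V (g \<otimes> h) = V g \<otimes> V h"
    "\<And>z. z \<in> Z \<Longrightarrow> V z = z [^] n"
proof -
  let ?Z = "G\<lparr>carrier := Z\<rparr>"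
  have Zsub: "Z \<subseteq> carrier G" using Z by (rule subgroup.subset)
  interpret ZG: comm_group ?Z
    using central Zsub by (intro group.group_comm_groupI subgroup_imp_group[OF Z]) auto
  have "\<forall>q\<in>rcosets Z. \<exists>a. a \<in> carrier G \<and> q = Z #> a" by (auto simp: RCOSETS_def)
  then obtain s where s: "\<And>q. q \<in> rcosets Z \<Longrightarrow> s q \<in> carrier G"
    "\<And>q. q \<in> rcosets Z \<Longrightarrow> Z #> s q = q"
    by metis
  have act_closed: "q #> g \<in> rcosets Z" if "q \<in> rcosets Z" "g \<in> carrier G" for q g
    using that Zsub by (auto simp: RCOSETS_def coset_mult_assoc)
  have act_mult: "q #> (g \<otimes> h) = (q #> g) #> h"
    if "q \<in> rcosets Z" "g \<in> carrier G" "h \<in> carrier G" for q g h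
    using that rcosets_part_G[OF Z] by (auto simp: coset_mult_assoc subgroup.rcosets_carrier[OF Z])
  define f where "f g q = s q \<otimes> g \<otimes> inv (s (q #> g))" for g q
  have f_Z: "f g q \<in> Z" if q: "q \<in> rcosets Z" and g: "g \<in> carrier G" for g q
  proof -
    have "Z #> (s q \<otimes> g) = Z #> s (q #> g)"
      using s[OF q] s[OF act_closed[OF q g]] g Zsub by (metis coset_mult_assoc)
    then show ?thesis unfolding f_def
      using r_coset_eqD[OF Z] s(1)[OF q] s(1)[OF act_closed[OF q g]] g by simp
  qed
  have f_cocycle: "f (g \<otimes> h) q = f g q \<otimes> f h (q #> g)"
    if q: "q \<in> rcosets Z" and g: "g \<in> carrier G" and h: "h \<in> carrier G" for g h q
  proof -
    note qg = act_closed[OF q g]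
    note qgh = act_closed[OF qg h]
    show ?thesis unfolding f_def act_mult[OF q g h]
      using s(1)[OF q] s(1)[OF qg] s(1)[OF qgh] g h by (simp add: m_assoc inv_solve_left)
  qed
  have f_central: "f z q = z" if q: "q \<in> rcosets Z" and z: "z \<in> Z" for z q
  proof -
    have zc: "z \<in> carrier G" using z Zsub by blast
    \<comment> \<open>A central element acts trivially on the cosets.\<close>
    have "q #> z = Z #> (s q \<otimes> z)" using s[OF q] zc Zsub by (metis coset_mult_assoc)
    also have "\<dots> = Z #> (z \<otimes> s q)" using central[OF z s(1)[OF q]] by simp
    also have "\<dots> = q"
      using s[OF q] zc z Zsub by (metis coset_mult_assoc coset_join2 Z)
    finally have "q #> z = q" .
    then show ?thesis
      unfolding f_def using central[OF z s(1)[OF q], symmetric] s(1)[OF q] zc by (simp add: m_assoc)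
  qed
  define V where "V g = finprod ?Z (f g) (rcosets Z)" for g
  have V_Z: "V g \<in> Z" if "g \<in> carrier G" for g
    using ZG.finprod_closed[of "f g" "rcosets Z"] f_Z that unfolding V_def by auto
  have V_mult: "V (g \<otimes> h) = V g \<otimes> V h" if g: "g \<in> carrier G" and h: "h \<in> carrier G" for g h
  proof -
    have inj: "inj_on (\<lambda>q. q #> g) (rcosets Z)"
    proof (rule inj_on_inverseI)
      fix q assume q: "q \<in> rcosets Z"
      show "(q #> g) #> inv g = q"
        using act_mult[OF q g inv_closed[OF g]] g q subgroup.rcosets_carrier[OF Z _ q]
        by (simp add: coset_mult_one is_group)
    qed
    then have surj: "(\<lambda>q. q #> g) ` (rcosets Z) = rcosets Z"
      using endo_inj_surj[OF fin _ inj] act_closed g by blast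
    have "V (g \<otimes> h) = finprod ?Z (\<lambda>q. f g q \<otimes>\<^bsub>?Z\<^esub> f h (q #> g)) (rcosets Z)"
      unfolding V_def using f_cocycle g h f_Z act_closed
      by (intro ZG.finprod_cong') (auto intro: subgroup.m_closed[OF Z])
    also have "\<dots> = V g \<otimes> finprod ?Z (\<lambda>q. f h (q #> g)) (rcosets Z)"
      unfolding V_def using f_Z act_closed g h by (subst ZG.finprod_multf) auto
    also have "finprod ?Z (\<lambda>q. f h (q #> g)) (rcosets Z) = V h"
      unfolding V_def using ZG.finprod_reindex[OF _ inj, of "f h"] surj f_Z h by auto
    finally show ?thesis .
  qed
  have "V z = z [^] card (rcosets Z)" if z: "z \<in> Z" for z
  proof -
    have "V z = finprod ?Z (\<lambda>_. z) (rcosets Z)"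
      unfolding V_def using f_central z by (intro ZG.finprod_cong') auto
    then show ?thesis using ZG.finprod_const[of z "rcosets Z"] z nat_pow_consistent[of z _ Z] by simp
  qed
  moreover have "card (rcosets Z) > 0"
    using fin rcosetsI[OF Zsub one_closed] by (auto simp: card_gt_0_iff)
  ultimately show ?thesis using that V_Z V_mult by blast
qed

definition torsion :: "'a set" where
  "torsion = {x \<in> carrier G. \<exists>n::nat. n > 0 \<and> x [^] n = \<one>}"


lemma torsion_iff: "x \<in> torsion \<longleftrightarrow> x \<in> carrier G \<and> (\<exists>n::nat. n > 0 \<and> x [^] n = \<one>)"
  by (simp add: torsion_def)

text \<open>
  Since some power of \<open>g\<close> lies in \<open>Z\<close>, where the transfer is a power map, \<open>g\<close> has finite order as soon as
  its transfer has. As the transfer takes values in an abelian group, commutators are sent to the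
  identity, and so is, up to torsion, the quotient of two elements with a common power. The first
  part is the torsion half of Schur's theorem that a group with centre of finite index has a finite
  derived subgroup.
\<close>

lemma torsion_if_central_finite_index:
  assumes Z: "subgroup Z G" and central: "\<And>z g. z \<in> Z \<Longrightarrow> g \<in> carrier G \<Longrightarrow> z \<otimes> g = g \<otimes> z"
    and fin: "finite (rcosets Z)"
    and x: "x \<in> carrier G" and y: "y \<in> carrier G"
  shows "x \<otimes> y \<otimes> inv x \<otimes> inv y \<in> torsion"
    and "\<And>k::nat. k > 0 \<Longrightarrow> x [^] k = y [^] k \<Longrightarrow> x \<otimes> inv y \<in> torsion"
proof -
  obtain V and n :: nat where n: "n > 0" and VZ: "\<And>g. g \<in> carrier G \<Longrightarrow> V g \<in> Z"
    and V_mult: "\<And>g h. g \<in> carrier G \<Longrightarrow> h \<in> carrier G \<Longrightarrow> V (g \<otimes> h) = V g \<otimes> V h"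
    and V_pow: "\<And>z. z \<in> Z \<Longrightarrow> V z = z [^] n"
    using transfer_to_central_subgroup[OF Z central fin] by metis
  have Vc: "V g \<in> carrier G" if "g \<in> carrier G" for g
    using VZ[OF that] subgroup.mem_carrier[OF Z] by blast
  interpret V: group_hom G G V
    using Vc V_mult by unfold_locales (auto simp: hom_def)
  have tors: "g \<in> torsion" if g: "g \<in> carrier G" and Vg: "V g \<in> torsion" for g
  proof -
    obtain m :: nat where m: "m > 0" "g [^] m \<in> Z" using finite_index_pow_mem[OF Z fin g] .
    obtain k :: nat where k: "k > 0" "V g [^] k = \<one>" using Vg by (auto simp: torsion_iff)
    have "((g [^] m) [^] n) [^] k = V (g [^] m) [^] k" using V_pow[OF m(2)] by simp
    also have "\<dots> = (V g [^] k) [^] m"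
      using g Vc[OF g] by (simp add: V.hom_nat_pow nat_pow_pow mult.commute)
    finally have "g [^] (m * n * k) = \<one>" using k g by (simp add: nat_pow_pow)
    moreover have "m * n * k > 0" using m n k by simp
    ultimately show ?thesis using g unfolding torsion_iff by blast
  qed
  have comm: "V x \<otimes> V y = V y \<otimes> V x" using central[OF VZ[OF x] Vc[OF y]] .
  have "V (x \<otimes> y \<otimes> inv x \<otimes> inv y) = V y \<otimes> V x \<otimes> inv V x \<otimes> inv V y"
    using x y comm by simp
  also have "\<dots> = \<one>" using Vc x y by (simp add: m_assoc)
  finally have "V (x \<otimes> y \<otimes> inv x \<otimes> inv y) \<in> torsion"
    by (auto simp: torsion_iff intro: exI[of _ 1])
  then show "x \<otimes> y \<otimes> inv x \<otimes> inv y \<in> torsion" using tors x y by simp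
  show "x \<otimes> inv y \<in> torsion" if k: "k > 0" "x [^] k = y [^] k" for k :: nat
  proof -
    have "V x \<otimes> inv V y = inv V y \<otimes> V x"
      using central[OF VZ[OF x], of "inv V y"] Vc y by simp
    then have "V (x \<otimes> inv y) [^] k = V x [^] k \<otimes> (inv V y) [^] k"
      using pow_mult_distrib[of "V x" "inv V y" k] x y Vc by simp
    also have "\<dots> = V (x [^] k) \<otimes> inv V (y [^] k)"
      using x y Vc by (simp add: V.hom_nat_pow nat_pow_inv)
    also have "\<dots> = \<one>" using k Vc y by simp
    finally have "V (x \<otimes> inv y) \<in> torsion" using k(1) x y unfolding torsion_iff by auto
    then show ?thesis using tors x y by simp
  qed
qed

lemma centraliser_subgroup: "x \<in> carrier G \<Longrightarrow> subgroup (centraliser G x) G"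
proof (rule subgroupI)
  assume x: "x \<in> carrier G"
  show "centraliser G x \<noteq> {}" using x by (auto simp: centraliser_def intro: exI[of _ \<one>])
  fix a assume "a \<in> centraliser G x"
  then have a: "a \<in> carrier G" and ax: "a \<otimes> x = x \<otimes> a" by (auto simp: centraliser_def)
  have "inv a \<otimes> x \<otimes> a = inv a \<otimes> (a \<otimes> x)" using a x ax by (metis inv_closed m_assoc)
  also have "\<dots> = x" using a x by (simp add: m_assoc[symmetric])
  finally have "inv a \<otimes> x = x \<otimes> inv a" using a x by (simp add: inv_solve_right)
  then show "inv a \<in> centraliser G x" using a by (simp add: centraliser_def)
  fix b assume "b \<in> centraliser G x"
  then have b: "b \<in> carrier G" and bx: "b \<otimes> x = x \<otimes> b" by (auto simp: centraliser_def)
  have "a \<otimes> b \<otimes> x = x \<otimes> (a \<otimes> b)" using a b x ax bx by (metis m_assoc)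
  then show "a \<otimes> b \<in> centraliser G x" using a b by (simp add: centraliser_def)
qed (auto simp: centraliser_def)

lemma set_centraliser_subgroup:
  assumes "M \<subseteq> carrier G"
  shows "subgroup {g \<in> carrier G. \<forall>z\<in>M. z \<otimes> g = g \<otimes> z} G"
proof -
  have "{g \<in> carrier G. \<forall>z\<in>M. z \<otimes> g = g \<otimes> z} = carrier G \<inter> (\<Inter>z\<in>M. centraliser G z)"
    by (auto simp: centraliser_def)
  moreover have "subgroup (carrier G \<inter> (\<Inter>z\<in>M. centraliser G z)) G"
    using subgroups_Inter[of "insert (carrier G) (centraliser G ` M)"] subgroup_self
      centraliser_subgroup assms by auto
  ultimately show ?thesis by simp
qed

text \<open>
  Groups all of whose elements have a centraliser of finite index are the FC-groups. Such a group
  need not have a centre of finite index, but the statement concerns only two elements at a time. With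
  \<open>M = C(x) \<inter> C(y)\<close>, the centraliser \<open>K\<close> of \<open>M\<close> contains \<open>x\<close> and \<open>y\<close>, and \<open>M \<inter> K\<close> is central and of finite
  index in \<open>K\<close>; so the transfer argument applies to \<open>K\<close>.
\<close>

lemma FC_torsion:
  assumes FC: "\<And>x. x \<in> carrier G \<Longrightarrow> finite (rcosets (centraliser G x))"
    and x: "x \<in> carrier G" and y: "y \<in> carrier G"
  shows FC_commutator_torsion: "x \<otimes> y \<otimes> inv x \<otimes> inv y \<in> torsion"
    and FC_pow_eq_torsion: "\<And>k::nat. k > 0 \<Longrightarrow> x [^] k = y [^] k \<Longrightarrow> x \<otimes> inv y \<in> torsion"
proof -
  let ?Cx = "centraliser G x" and ?Cy = "centraliser G y"
  define M where "M = ?Cx \<inter> ?Cy"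
  define K where "K = {g \<in> carrier G. \<forall>z\<in>M. z \<otimes> g = g \<otimes> z}"
  let ?K = "G\<lparr>carrier := K\<rparr>"
  define Z where "Z = M \<inter> K"
  have Ksub: "subgroup K G"
    unfolding K_def by (rule set_centraliser_subgroup) (auto simp: M_def centraliser_def)
  have Zsub: "subgroup Z G"
    unfolding Z_def M_def using Ksub centraliser_subgroup x y by (intro subgroups_Inter_pair)
  have xy: "x \<in> K" "y \<in> K" using x y by (auto simp: K_def M_def centraliser_def)
  interpret K: group ?K using Ksub by (rule subgroup_imp_group)
  have "Z #> g = Z #> h"
    if "g \<in> K" "h \<in> K" "(?Cx #> g, ?Cy #> g) = (?Cx #> h, ?Cy #> h)" for g h
  proof (rule r_coset_eqI[OF Zsub])
    show gh: "g \<in> carrier G" "h \<in> carrier G" using that by (auto simp: K_def)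
    show "g \<otimes> inv h \<in> Z" unfolding Z_def M_def
      using r_coset_eqD[of ?Cx g h] r_coset_eqD[of ?Cy g h] centraliser_subgroup x y gh that
        subgroup.m_closed[OF Ksub] subgroup.m_inv_closed[OF Ksub] by auto
  qed
  moreover have "(\<lambda>g. (?Cx #> g, ?Cy #> g)) ` K \<subseteq> (rcosets ?Cx) \<times> (rcosets ?Cy)"
    by (auto simp: K_def RCOSETS_def)
  then have "finite ((\<lambda>g. (?Cx #> g, ?Cy #> g)) ` K)"
    using FC x y by (meson finite_SigmaI finite_subset)
  ultimately have "finite ((\<lambda>g. Z #> g) ` K)"
    by (intro finite_image_if_determined[where f = "\<lambda>g. (?Cx #> g, ?Cy #> g)" and g = "\<lambda>g. Z #> g"])
  moreover have "rcosets\<^bsub>?K\<^esub> Z = (\<lambda>g. Z #> g) ` K"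
    by (auto simp: RCOSETS_def r_coset_def)
  ultimately have fin: "finite (rcosets\<^bsub>?K\<^esub> Z)" by simp
  have ZK: "subgroup Z ?K" using Zsub Ksub by (simp add: Z_def subgroup_incl)
  have central: "z \<otimes>\<^bsub>?K\<^esub> g = g \<otimes>\<^bsub>?K\<^esub> z" if "z \<in> Z" "g \<in> carrier ?K" for z g
    using that by (auto simp: Z_def K_def)
  have inv: "inv\<^bsub>?K\<^esub> x = inv x" "inv\<^bsub>?K\<^esub> y = inv y" using xy Ksub by simp_all
  have tors: "g \<in> K.torsion \<longleftrightarrow> g \<in> torsion" if "g \<in> K" for g
    using that subgroup.mem_carrier[OF Ksub that]
    by (simp add: torsion_iff K.torsion_iff nat_pow_consistent[symmetric])
  have mem: "x \<otimes> inv y \<in> K" "x \<otimes> y \<otimes> inv x \<otimes> inv y \<in> K"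
    using xy by (auto intro!: subgroup.m_closed[OF Ksub] subgroup.m_inv_closed[OF Ksub])
  show "x \<otimes> y \<otimes> inv x \<otimes> inv y \<in> torsion"
    using K.torsion_if_central_finite_index(1)[OF ZK central fin, of x y] xy mem tors inv by auto
  show "x \<otimes> inv y \<in> torsion" if "k > 0" "x [^] k = y [^] k" for k :: nat
    using K.torsion_if_central_finite_index(2)[OF ZK central fin, of x y k] xy mem tors inv that
    by (simp add: nat_pow_consistent[symmetric])
qed

text \<open>
  A product \<open>x \<otimes> y\<close> of torsion elements is the quotient of \<open>x\<close> and \<open>inv y\<close>, which have a common
  power equal to the identity; a conjugate of a torsion element differs from it by a commutator.
\<close>

lemma FC_torsion_normal:
  assumes FC: "\<And>x. x \<in> carrier G \<Longrightarrow> finite (rcosets (centraliser G x))"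
  shows "torsion \<lhd> G"
proof -
  have mult: "x \<otimes> y \<in> torsion" if x: "x \<in> torsion" and y: "y \<in> torsion" for x y
  proof -
    obtain p :: nat where p: "p > 0" "x [^] p = \<one>" "x \<in> carrier G"
      using x by (auto simp: torsion_iff)
    obtain q :: nat where q: "q > 0" "y [^] q = \<one>" "y \<in> carrier G"
      using y by (auto simp: torsion_iff)
    have "x [^] (p * q) = (x [^] p) [^] q" "y [^] (p * q) = (y [^] q) [^] p"
      using nat_pow_pow[OF p(3), of p q] nat_pow_pow[OF q(3), of q p] by (simp_all add: mult.commute)
    then have "x [^] (p * q) = (inv y) [^] (p * q)" using p q by (simp add: nat_pow_inv)
    then show ?thesis using FC_pow_eq_torsion[OF FC, of x "inv y" "p * q"] p q by simp
  qed
  have sub: "subgroup torsion G"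
  proof (rule subgroupI)
    have "\<one> \<in> torsion" by (auto simp: torsion_iff intro: exI[of _ 1])
    then show "torsion \<noteq> {}" by blast
    show "inv x \<in> torsion" if "x \<in> torsion" for x
      using that by (auto simp: torsion_iff nat_pow_inv)
    show "x \<otimes> y \<in> torsion" if "x \<in> torsion" "y \<in> torsion" for x y
      using that by (rule mult)
  qed (auto simp: torsion_iff)
  show ?thesis
  proof (rule normal_invI[OF sub])
    fix x h assume x: "x \<in> carrier G" and h: "h \<in> torsion"
    then have hc: "h \<in> carrier G" by (simp add: torsion_iff)
    have "(x \<otimes> h \<otimes> inv x \<otimes> inv h) \<otimes> h \<in> torsion"
      using FC_commutator_torsion[OF FC x hc] h by (rule mult)
    then show "x \<otimes> h \<otimes> inv x \<in> torsion" using x hc by (simp add: m_assoc)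
  qed
qed

lemma surj_hom_finite_index:
  assumes "group_hom G H h" and surj: "h ` carrier G = carrier H"
    and K: "subgroup K G" and L: "subgroup L H" and KL: "h ` K \<subseteq> L"
    and fin: "finite (rcosets K)"
  shows "finite (rcosets\<^bsub>H\<^esub> L)"
proof -
  interpret h: group_hom G H h by fact
  obtain Y where Y: "finite Y" "Y \<subseteq> carrier G"
    "\<And>g. g \<in> carrier G \<Longrightarrow> \<exists>y\<in>Y. \<exists>k\<in>K. g = k \<otimes> y"
    using finite_index_transversal[OF K fin] by blast
  show ?thesis
  proof (rule h.H.finite_index_if_transversal[OF L, of "h ` Y"])
    fix a assume "a \<in> carrier H"
    then obtain g where g: "g \<in> carrier G" "a = h g" using surj by blast
    then obtain y k where "y \<in> Y" "k \<in> K" "g = k \<otimes> y" using Y(3) by blast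
    moreover from this have "h g = h k \<otimes>\<^bsub>H\<^esub> h y"
      using Y(2) subgroup.mem_carrier[OF K] by (simp add: subset_iff)
    ultimately have "h y \<in> h ` Y" "h k \<in> L" "a = h k \<otimes>\<^bsub>H\<^esub> h y"
      using g KL by auto
    then show "\<exists>y\<in>h ` Y. \<exists>k\<in>L. a = k \<otimes>\<^bsub>H\<^esub> y" by blast
  qed (use Y in auto)
qed

end

section \<open>Skew braces and their stabilisers\<close>

(* The dot stands for multiples [n] \<cdot> x below; as the product of ideals it makes them ambiguous. *)
no_notation ideal_prod (infixl \<open>\<cdot>\<index>\<close> 80)

context skew_brace begin

sublocale add: group "add_monoid B"
  rewrites "carrier (add_monoid B) = carrier B"
    and "monoid.mult (add_monoid B) = (\<oplus>)"
    and "one (add_monoid B) = \<zero>"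
    and "m_inv (add_monoid B) = a_inv B"
    and "pow (add_monoid B) = (\<lambda>a k. add_pow B k a)"
  by (rule add_group) (auto simp: m_inv_def a_inv_def add_pow_def)

abbreviation lambda :: "'a \<Rightarrow> 'a \<Rightarrow> 'a" (\<open>\<Lambda>\<close>) where "\<Lambda> \<equiv> brace_lambda B"

lemma lambda_closed [simp]: "a \<in> carrier B \<Longrightarrow> b \<in> carrier B \<Longrightarrow> \<Lambda> a b \<in> carrier B"
  by (simp add: brace_lambda_def)

lemma mult_eq_add_lambda:
  "a \<in> carrier B \<Longrightarrow> b \<in> carrier B \<Longrightarrow> a \<otimes> b = a \<oplus> \<Lambda> a b"
  by (simp add: brace_lambda_def add.m_assoc[symmetric])

lemma lambda_add:
  assumes "a \<in> carrier B" "b \<in> carrier B" "c \<in> carrier B"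
  shows "\<Lambda> a (b \<oplus> c) = \<Lambda> a b \<oplus> \<Lambda> a c"
  using assms by (simp add: brace_lambda_def brace_distrib a_minus_def add.m_assoc)

lemma lambda_group_hom: "a \<in> carrier B \<Longrightarrow> group_hom (add_monoid B) (add_monoid B) (\<Lambda> a)"
  by unfold_locales (auto simp: hom_def lambda_add)

lemma lambda_zero: "a \<in> carrier B \<Longrightarrow> \<Lambda> a \<zero> = \<zero>"
  using group_hom.hom_one[OF lambda_group_hom] by simp

lemma lambda_minus: "a \<in> carrier B \<Longrightarrow> b \<in> carrier B \<Longrightarrow> \<Lambda> a (\<ominus> b) = \<ominus> \<Lambda> a b"
  using group_hom.hom_inv[OF lambda_group_hom] by (simp add: a_inv_def)

lemma lambda_nat_mult:
  "a \<in> carrier B \<Longrightarrow> b \<in> carrier B \<Longrightarrow> \<Lambda> a ([(n::nat)] \<cdot> b) = [n] \<cdot> \<Lambda> a b"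
  using group_hom.hom_nat_pow[OF lambda_group_hom] by (simp add: add_pow_def)

lemma lambda_one: "b \<in> carrier B \<Longrightarrow> \<Lambda> \<one> b = b"
proof -
  assume b: "b \<in> carrier B"
  have "\<ominus> \<one> = \<zero>" by (simp only: zero_eq_one[symmetric] add.inv_one)
  then show ?thesis using b by (simp add: brace_lambda_def)
qed

lemma lambda_mult:
  assumes a: "a \<in> carrier B" and b: "b \<in> carrier B" and c: "c \<in> carrier B"
  shows "\<Lambda> (a \<otimes> b) c = \<Lambda> a (\<Lambda> b c)"
proof -
  have "a \<oplus> (\<Lambda> a b \<oplus> \<Lambda> a (\<Lambda> b c)) = a \<otimes> (b \<otimes> c)"
    using assms by (simp add: mult_eq_add_lambda lambda_add)
  also have "\<dots> = (a \<otimes> b) \<otimes> c" using assms by (simp add: m_assoc)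
  also have "\<dots> = a \<oplus> (\<Lambda> a b \<oplus> \<Lambda> (a \<otimes> b) c)"
    using assms by (simp add: mult_eq_add_lambda[of "a \<otimes> b"]) (simp add: mult_eq_add_lambda add.m_assoc)
  finally show ?thesis using assms by simp
qed

lemma lambda_inv_fixed:
  assumes "a \<in> carrier B" "b \<in> carrier B" "\<Lambda> a b = b"
  shows "\<Lambda> (inv a) b = b"
  using lambda_mult[of "inv a" a b] assms by (simp add: lambda_one)

lemma lambda_pow_fixed:
  assumes "a \<in> carrier B" "b \<in> carrier B" "\<Lambda> a b = b"
  shows "\<Lambda> (a [^] (n::nat)) b = b"
  using assms by (induction n) (auto simp: lambda_one lambda_mult)

text \<open>
  Additive multiples behave well in the second argument of \<open>\<Lambda>\<close> and multiplicative powers in the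
  first one; they can be exchanged for elements that are fixed by their own \<open>\<Lambda>\<close>.
\<close>

lemma pow_eq_nat_mult:
  assumes "a \<in> carrier B" "\<Lambda> a a = a"
  shows "a [^] (n::nat) = [n] \<cdot> a"
proof (induction n)
  case 0
  then show ?case using zero_eq_one by simp
next
  case (Suc n)
  have "a [^] Suc n = a \<oplus> \<Lambda> a ([n] \<cdot> a)"
    using assms Suc nat_pow_Suc2[of a n] by (simp only: mult_eq_add_lambda add.nat_pow_closed)
  also have "\<dots> = [Suc n] \<cdot> a"
    using assms add.nat_pow_Suc2[of a n] by (simp only: lambda_nat_mult)
  finally show ?case .
qed

lemma star_eq_zero_iff:
  "a \<in> carrier B \<Longrightarrow> b \<in> carrier B \<Longrightarrow> brace_star B a b = \<zero> \<longleftrightarrow> \<Lambda> a b = b"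
  by (simp add: brace_star_def a_minus_def add.inv_solve_right')

text \<open>
  These are the two subgroups whose indices property (s) requires to be finite: the elements \<open>b\<close>
  with \<open>x \<otimes> b = x \<oplus> b = b \<oplus> x\<close>, and those with \<open>b \<otimes> x = b \<oplus> x\<close> and \<open>b \<otimes> x = x \<otimes> b\<close>. The
  first is a subgroup for \<open>\<oplus>\<close>, because \<open>\<Lambda> x\<close> is additive, and the second for \<open>\<otimes>\<close>, because
  \<open>\<Lambda>\<close> is multiplicative in its first argument.
\<close>

definition right_stabiliser :: "'a \<Rightarrow> 'a set" where
  "right_stabiliser x = Fix_r B x \<inter> centraliser (add_monoid B) x"

definition left_stabiliser :: "'a \<Rightarrow> 'a set" where
  "left_stabiliser x = Fix_l B x \<inter> centraliser B x"

lemma right_stabiliser_iff: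
  "x \<in> carrier B \<Longrightarrow> b \<in> right_stabiliser x \<longleftrightarrow> b \<in> carrier B \<and> \<Lambda> x b = b \<and> b \<oplus> x = x \<oplus> b"
  by (auto simp: right_stabiliser_def Fix_r_def centraliser_def star_eq_zero_iff)

lemma left_stabiliser_iff:
  "x \<in> carrier B \<Longrightarrow> b \<in> left_stabiliser x \<longleftrightarrow> b \<in> carrier B \<and> \<Lambda> b x = x \<and> b \<otimes> x = x \<otimes> b"
  by (auto simp: left_stabiliser_def Fix_l_def centraliser_def star_eq_zero_iff)

lemma right_stabiliser_subgroup:
  assumes x: "x \<in> carrier B"
  shows "subgroup (right_stabiliser x) (add_monoid B)"
proof -
  have "subgroup (centraliser (add_monoid B) x) (add_monoid B)"
    using x by (intro add.centraliser_subgroup) simp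
  moreover have "subgroup (Fix_r B x) (add_monoid B)"
    using x by (intro add.subgroupI)
      (auto simp: Fix_r_def star_eq_zero_iff lambda_minus lambda_add lambda_zero intro: exI[of _ \<zero>])
  ultimately show ?thesis
    unfolding right_stabiliser_def by (intro add.subgroups_Inter_pair)
qed

lemma left_stabiliser_subgroup:
  assumes x: "x \<in> carrier B"
  shows "subgroup (left_stabiliser x) B"
proof -
  have "subgroup (Fix_l B x) B"
    using x by (intro subgroupI)
      (auto simp: Fix_l_def star_eq_zero_iff lambda_inv_fixed lambda_mult lambda_one intro: exI[of _ \<one>])
  then show ?thesis
    unfolding left_stabiliser_def using centraliser_subgroup[OF x] by (intro subgroups_Inter_pair)
qed

lemma property_S_stabilisers:
  assumes "property_S B" "x \<in> carrier B"
  shows "finite (rcosets\<^bsub>add_monoid B\<^esub> (right_stabiliser x))"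
    and "finite (rcosets (left_stabiliser x))"
  using assms by (auto simp: property_S_def property_s_def right_stabiliser_def left_stabiliser_def)

section \<open>Every element has a multiple in the annihilator\<close>

text \<open>
  This is the annihilator of the skew brace in the usual sense, that is the intersection of the centre
  of the additive group, the centre of the multiplicative group and the kernel of \<open>\<Lambda>\<close>: if \<open>z\<close> is
  additively central and in the kernel, then \<open>\<Lambda> b z = z\<close> says that \<open>z\<close> commutes with \<open>b\<close> for \<open>\<otimes>\<close>.
\<close>

definition annihilator :: "'a set" where
  "annihilator = {z \<in> carrier B. \<forall>b\<in>carrier B. z \<oplus> b = b \<oplus> z \<and> \<Lambda> b z = z \<and> \<Lambda> z b = b}"

text \<open>
  The elements that commute additively with \<open>x\<close> include \<open>right_stabiliser x\<close>, and those \<open>b\<close> with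
  \<open>\<Lambda> b x = x\<close> include \<open>left_stabiliser x\<close>, so every multiple of \<open>x\<close> has both properties with respect to
  these subgroups of finite index. Only finitely many representatives remain, and a suitable multiple
  lies in the right stabiliser of each of them.
\<close>

lemma multiple_central_and_lambda_fixed:
  assumes S: "property_S B" and x: "x \<in> carrier B"
  obtains n :: nat where "n > 0"
    "\<And>b. b \<in> carrier B \<Longrightarrow> [n] \<cdot> x \<oplus> b = b \<oplus> [n] \<cdot> x \<and> \<Lambda> b ([n] \<cdot> x) = [n] \<cdot> x"
proof -
  obtain Y where Y: "finite Y" "Y \<subseteq> carrier B"
    "\<And>b. b \<in> carrier B \<Longrightarrow> \<exists>y\<in>Y. \<exists>h\<in>right_stabiliser x. b = h \<oplus> y"
    using add.finite_index_transversal[OF right_stabiliser_subgroup[OF x] property_S_stabilisers(1)[OF S x]]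
    by blast
  obtain U where U: "finite U" "U \<subseteq> carrier B"
    "\<And>b. b \<in> carrier B \<Longrightarrow> \<exists>u\<in>U. \<exists>k\<in>left_stabiliser x. b = k \<otimes> u"
    using finite_index_transversal[OF left_stabiliser_subgroup[OF x] property_S_stabilisers(2)[OF S x]]
    by blast
  have YU: "finite (Y \<union> U)" "\<And>u. u \<in> Y \<union> U \<Longrightarrow> u \<in> carrier B" using Y(1,2) U(1,2) by auto
  have "\<exists>n::nat. n > 0 \<and> (\<forall>u\<in>Y \<union> U. [n] \<cdot> x \<in> right_stabiliser u)"
    by (rule add.finite_index_common_pow_mem[OF YU(1)])
      (simp_all only: YU(2) right_stabiliser_subgroup property_S_stabilisers(1)[OF S] x)
  then obtain n :: nat where n: "n > 0" "\<forall>u\<in>Y \<union> U. [n] \<cdot> x \<in> right_stabiliser u" by blast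
  let ?v = "[n] \<cdot> x"
  have v: "?v \<in> carrier B" using x by simp
  have "?v \<oplus> b = b \<oplus> ?v \<and> \<Lambda> b ?v = ?v" if b: "b \<in> carrier B" for b
  proof
    obtain y h where yh: "y \<in> Y" "h \<in> right_stabiliser x" "b = h \<oplus> y" using Y(3)[OF b] by blast
    have yc: "y \<in> carrier B" using yh Y by blast
    have hc: "h \<in> carrier B" and hx: "h \<oplus> x = x \<oplus> h" using yh x by (auto simp: right_stabiliser_iff)
    have "x \<in> centraliser (add_monoid B) h" using x hx by (simp add: centraliser_def)
    then have "?v \<in> centraliser (add_monoid B) h"
      by (rule add.subgroup_nat_pow_mem[OF add.centraliser_subgroup[OF hc]])
    then have vh: "?v \<oplus> h = h \<oplus> ?v" by (simp add: centraliser_def)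
    have vy: "?v \<oplus> y = y \<oplus> ?v" using n(2)[THEN bspec, of y] yh yc by (simp add: right_stabiliser_iff)
    show "?v \<oplus> b = b \<oplus> ?v" using vh vy v hc yc yh(3) by (metis add.m_assoc)
    obtain u k where uk: "u \<in> U" "k \<in> left_stabiliser x" "b = k \<otimes> u" using U(3)[OF b] by blast
    have uc: "u \<in> carrier B" using uk U by blast
    have kc: "k \<in> carrier B" and kx: "\<Lambda> k x = x" using uk x by (auto simp: left_stabiliser_iff)
    have "\<Lambda> u ?v = ?v" using n(2)[THEN bspec, of u] uk uc by (simp add: right_stabiliser_iff)
    moreover have "\<Lambda> k ?v = ?v" using kx kc x by (simp add: lambda_nat_mult)
    ultimately show "\<Lambda> b ?v = ?v" using kc uc uk(3) v by (simp add: lambda_mult)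
  qed
  then show ?thesis using that n(1) by blast
qed

text \<open>
  Let \<open>v\<close> be a multiple of \<open>x\<close> as in the previous lemma. Then \<open>\<Lambda> v\<close> is the identity on a subgroup of
  finite additive index, and a suitable power of \<open>v\<close> lies in the left stabilisers of the remaining
  representatives, so its \<open>\<Lambda>\<close> is the identity. Since \<open>\<Lambda> v v = v\<close>, this power is also a multiple
  of \<open>v\<close>, and therefore still central and fixed by every \<open>\<Lambda> b\<close>.
\<close>

lemma multiple_in_annihilator:
  assumes S: "property_S B" and x: "x \<in> carrier B"
  obtains n :: nat where "n > 0" "[n] \<cdot> x \<in> annihilator"
proof -
  obtain n :: nat where n: "n > 0"
    "\<And>b. b \<in> carrier B \<Longrightarrow> [n] \<cdot> x \<oplus> b = b \<oplus> [n] \<cdot> x \<and> \<Lambda> b ([n] \<cdot> x) = [n] \<cdot> x"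
    using multiple_central_and_lambda_fixed[OF S x] by blast
  define v where "v = [n] \<cdot> x"
  have v: "v \<in> carrier B" using x by (simp add: v_def)
  have v_fixed: "\<Lambda> b v = v" if "b \<in> carrier B" for b using n(2) that by (simp add: v_def)
  obtain Y where Y: "finite Y" "Y \<subseteq> carrier B"
    "\<And>b. b \<in> carrier B \<Longrightarrow> \<exists>y\<in>Y. \<exists>h\<in>right_stabiliser v. b = h \<oplus> y"
    using add.finite_index_transversal[OF right_stabiliser_subgroup[OF v] property_S_stabilisers(1)[OF S v]]
    by blast
  have YB: "\<And>y. y \<in> Y \<Longrightarrow> y \<in> carrier B" using Y(2) by auto
  have "\<exists>m::nat. m > 0 \<and> (\<forall>y\<in>Y. v [^] m \<in> left_stabiliser y)"
    by (rule finite_index_common_pow_mem[OF Y(1)])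
      (simp_all only: YB left_stabiliser_subgroup property_S_stabilisers(2)[OF S] v)
  then obtain m :: nat where m: "m > 0" "\<forall>y\<in>Y. v [^] m \<in> left_stabiliser y" by blast
  have vm: "v [^] m = [m] \<cdot> v" using pow_eq_nat_mult[OF v v_fixed[OF v]] .
  have "\<Lambda> (v [^] m) b = b" if b: "b \<in> carrier B" for b
  proof -
    obtain y h where yh: "y \<in> Y" "h \<in> right_stabiliser v" "b = h \<oplus> y" using Y(3)[OF b] by blast
    have yc: "y \<in> carrier B" using yh Y by blast
    have hc: "h \<in> carrier B" and hv: "\<Lambda> v h = h" using yh v by (auto simp: right_stabiliser_iff)
    have "\<Lambda> (v [^] m) h = h" using lambda_pow_fixed v hc hv by blast
    moreover have "\<Lambda> (v [^] m) y = y" using m(2)[THEN bspec, OF yh(1)] yc by (simp add: left_stabiliser_iff)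
    ultimately show ?thesis using yh(3) v hc yc by (simp add: lambda_add)
  qed
  moreover have "\<Lambda> b ([m] \<cdot> v) = [m] \<cdot> v" if "b \<in> carrier B" for b
    using that v v_fixed by (simp add: lambda_nat_mult)
  moreover have "[m] \<cdot> v \<oplus> b = b \<oplus> [m] \<cdot> v" if b: "b \<in> carrier B" for b
  proof -
    have "v \<in> centraliser (add_monoid B) b" using v n(2)[OF b] by (simp add: centraliser_def v_def)
    then have "[m] \<cdot> v \<in> centraliser (add_monoid B) b"
      by (rule add.subgroup_nat_pow_mem[OF add.centraliser_subgroup[OF b]])
    then show ?thesis by (simp add: centraliser_def)
  qed
  ultimately have "[m] \<cdot> v \<in> annihilator" using v vm by (simp add: annihilator_def)
  moreover have "[m] \<cdot> v = [(n * m)] \<cdot> x" using x by (simp add: v_def add.nat_pow_pow)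
  ultimately show ?thesis using that[of "n * m"] n(1) m(1) by simp
qed

end

section \<open>The torsion part and the annihilator as ideals\<close>

context skew_brace begin

abbreviation torsion_part :: "'a set" where
  "torsion_part \<equiv> group.torsion (add_monoid B)"

lemma torsion_part_iff:
  "x \<in> torsion_part \<longleftrightarrow> x \<in> carrier B \<and> (\<exists>n::nat. n > 0 \<and> [n] \<cdot> x = \<zero>)"
  using add.torsion_iff by simp

lemma property_S_FC:
  assumes "property_S B" "x \<in> carrier B"
  shows "finite (rcosets\<^bsub>add_monoid B\<^esub> (centraliser (add_monoid B) x))"
  by (rule add.finite_index_mono[OF right_stabiliser_subgroup[OF assms(2)] _ _
        property_S_stabilisers(1)[OF assms]])
     (use assms(2) add.centraliser_subgroup in \<open>auto simp: right_stabiliser_def\<close>)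

lemma torsion_part_normal:
  assumes "property_S B"
  shows "torsion_part \<lhd> add_monoid B"
  using property_S_FC[OF assms] by (rule add.FC_torsion_normal)

lemma add_commutator_torsion:
  assumes S: "property_S B" and "a \<in> carrier B" "b \<in> carrier B"
  shows "a \<oplus> b \<oplus> \<ominus> a \<oplus> \<ominus> b \<in> torsion_part"
  by (rule add.FC_commutator_torsion[OF property_S_FC[OF S] assms(2,3)])

text \<open>
  A positive multiple of \<open>b\<close> lies in the subgroup of finite index fixed by \<open>\<Lambda> a\<close>, so \<open>b\<close> and
  \<open>\<Lambda> a b\<close> have a common multiple; in an FC-group this forces their difference to be torsion.
\<close>

lemma star_torsion:
  assumes S: "property_S B" and a: "a \<in> carrier B" and b: "b \<in> carrier B"
  shows "\<Lambda> a b \<oplus> \<ominus> b \<in> torsion_part"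
proof -
  obtain k :: nat where k: "k > 0" "[k] \<cdot> b \<in> right_stabiliser a"
    by (rule add.finite_index_pow_mem[OF right_stabiliser_subgroup[OF a] property_S_stabilisers(1)[OF S a] b])
  then have "[k] \<cdot> \<Lambda> a b = [k] \<cdot> b"
    using a b by (simp add: right_stabiliser_iff lambda_nat_mult)
  then show ?thesis
    using add.FC_pow_eq_torsion[OF property_S_FC[OF S] lambda_closed[OF a b] b k(1)] by simp
qed

text \<open>
  Since \<open>a \<otimes> b = a \<oplus> \<Lambda> a b\<close>, the two products differ by a conjugate of \<open>\<Lambda> a b \<oplus> \<ominus> b\<close>.
\<close>

lemma torsion_coset_mult:
  assumes S: "property_S B" and a: "a \<in> carrier B" and b: "b \<in> carrier B"
  shows "torsion_part +> (a \<otimes> b) = torsion_part +> (a \<oplus> b)"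
proof -
  interpret T: normal torsion_part "add_monoid B" by (rule torsion_part_normal[OF S])
  let ?t = "\<Lambda> a b \<oplus> \<ominus> b"
  have t: "?t \<in> torsion_part" by (rule star_torsion[OF S a b])
  have "a \<otimes> b \<oplus> \<ominus> (a \<oplus> b) = a \<oplus> ?t \<oplus> \<ominus> a"
    using a b by (simp add: mult_eq_add_lambda add.m_assoc add.inv_mult_group)
  then have "a \<otimes> b \<oplus> \<ominus> (a \<oplus> b) \<in> torsion_part" using T.inv_op_closed2[of a ?t] a t by (simp add: a_inv_def)
  then show ?thesis unfolding a_r_coset_def
    using add.r_coset_eqI[OF T.subgroup_axioms, of "a \<otimes> b" "a \<oplus> b"] a b by simp
qed

lemma torsion_coset_add_commute:
  assumes S: "property_S B" and a: "a \<in> carrier B" and b: "b \<in> carrier B"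
  shows "torsion_part +> (a \<oplus> b) = torsion_part +> (b \<oplus> a)"
proof -
  interpret T: normal torsion_part "add_monoid B" by (rule torsion_part_normal[OF S])
  have "a \<oplus> b \<oplus> \<ominus> (b \<oplus> a) \<in> torsion_part"
    using add_commutator_torsion[OF S a b] a b by (simp add: add.m_assoc add.inv_mult_group)
  then show ?thesis unfolding a_r_coset_def
    using add.r_coset_eqI[OF T.subgroup_axioms, of "a \<oplus> b" "b \<oplus> a"] a b by simp
qed

lemma annihilatorD:
  assumes "z \<in> annihilator"
  shows annihilator_closed: "z \<in> carrier B"
    and annihilator_commute: "b \<in> carrier B \<Longrightarrow> z \<oplus> b = b \<oplus> z"
    and lambda_annihilator: "b \<in> carrier B \<Longrightarrow> \<Lambda> b z = z"
    and annihilator_lambda: "b \<in> carrier B \<Longrightarrow> \<Lambda> z b = b"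
  using assms unfolding annihilator_def by blast+

lemma annihilator_mult: "z \<in> annihilator \<Longrightarrow> b \<in> carrier B \<Longrightarrow> z \<otimes> b = z \<oplus> b"
  by (simp add: annihilator_closed annihilator_lambda mult_eq_add_lambda)

lemma annihilator_mult_left: "z \<in> annihilator \<Longrightarrow> b \<in> carrier B \<Longrightarrow> b \<otimes> z = z \<oplus> b"
  using annihilator_commute[of z b]
  by (simp add: annihilator_closed lambda_annihilator mult_eq_add_lambda)

lemma annihilator_subgroup: "subgroup annihilator (add_monoid B)"
proof (rule add.subgroupI)
  show "annihilator \<noteq> {}"
    using lambda_one[unfolded zero_eq_one[symmetric]]
    by (auto simp: annihilator_def lambda_zero intro!: exI[of _ \<zero>])
  show "annihilator \<subseteq> carrier B" using annihilator_closed by blast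
  fix z assume z: "z \<in> annihilator"
  note zc = annihilator_closed[OF z]
  have "\<ominus> z \<oplus> b = b \<oplus> \<ominus> z" if b: "b \<in> carrier B" for b
  proof -
    have "z \<oplus> (b \<oplus> \<ominus> z) = b \<oplus> z \<oplus> \<ominus> z"
      using annihilator_commute[OF z b] zc b by (simp add: add.m_assoc[symmetric])
    then have "b = z \<oplus> (b \<oplus> \<ominus> z)" using zc b by (simp add: add.m_assoc)
    then show ?thesis using add.inv_solve_left[of "b \<oplus> \<ominus> z" z b] zc b by simp
  qed
  moreover have "\<Lambda> (\<ominus> z) b = b" if "b \<in> carrier B" for b
  proof -
    have "z \<otimes> \<ominus> z = \<one>" using z zc zero_eq_one by (simp add: annihilator_mult)
    then have "inv (\<ominus> z) = z" using inv_equality[of z "\<ominus> z"] zc by simp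
    then have "\<ominus> z = inv z" using inv_inv[of "\<ominus> z"] zc by simp
    then show ?thesis using lambda_inv_fixed[OF zc that annihilator_lambda[OF z that]] by simp
  qed
  ultimately show "\<ominus> z \<in> annihilator"
    unfolding annihilator_def using zc lambda_annihilator[OF z] by (simp add: lambda_minus)
  fix y assume y: "y \<in> annihilator"
  note yc = annihilator_closed[OF y]
  have "z \<oplus> y \<oplus> b = b \<oplus> (z \<oplus> y)" if b: "b \<in> carrier B" for b
  proof -
    have "z \<oplus> y \<oplus> b = z \<oplus> (b \<oplus> y)"
      using annihilator_commute[OF y b] zc yc b by (simp add: add.m_assoc)
    also have "\<dots> = b \<oplus> z \<oplus> y"
      using annihilator_commute[OF z b] zc yc b by (simp add: add.m_assoc[symmetric])
    finally show ?thesis using zc yc b by (simp add: add.m_assoc)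
  qed
  moreover have "\<Lambda> (z \<oplus> y) b = b" if b: "b \<in> carrier B" for b
    using lambda_mult[OF zc yc b] annihilator_lambda[OF y b] annihilator_lambda[OF z b]
    by (simp add: annihilator_mult[OF z yc])
  ultimately show "z \<oplus> y \<in> annihilator"
    unfolding annihilator_def using zc yc lambda_annihilator[OF y] lambda_annihilator[OF z]
    by (simp add: lambda_add)
qed

lemma subgroup_of_annihilator_normal:
  assumes Z: "subgroup Z (add_monoid B)" and sub: "Z \<subseteq> annihilator"
  shows "Z \<lhd> add_monoid B"
proof (rule add.normal_invI[OF Z])
  fix x h assume x: "x \<in> carrier B" and h: "h \<in> Z"
  then have "x \<oplus> h = h \<oplus> x" "h \<in> carrier B"
    using sub annihilator_closed annihilator_commute[of h x] by auto
  then show "x \<oplus> h \<oplus> \<ominus> x \<in> Z" using x h by (simp add: add.m_assoc)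
qed

text \<open>
  Elements of the annihilator can be moved out of any \<open>\<otimes>\<close>-product, where they become additive
  summands. Hence every additive subgroup of the annihilator is an ideal.
\<close>

lemma annihilator_coset_mult_cong:
  assumes Z: "subgroup Z (add_monoid B)" and sub: "Z \<subseteq> annihilator"
    and c: "a \<in> carrier B" "a' \<in> carrier B" "b \<in> carrier B" "b' \<in> carrier B"
    and eq: "Z +> a = Z +> a'" "Z +> b = Z +> b'"
  shows "Z +> (a \<otimes> b) = Z +> (a' \<otimes> b')"
proof -
  have "\<exists>z\<in>Z. x = z \<oplus> x'" if "x \<in> carrier B" "Z +> x = Z +> x'" for x x'
    using add.rcos_self[of x Z] Z that by (auto simp: a_r_coset_def r_coset_def)
  then obtain z w where z: "z \<in> Z" "a = z \<oplus> a'" and w: "w \<in> Z" "b = w \<oplus> b'"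
    using eq c by metis
  have zc: "z \<in> carrier B" "w \<in> carrier B" and ann: "z \<in> annihilator" "w \<in> annihilator"
    using z w sub annihilator_closed by auto
  have "a \<otimes> b = (z \<otimes> a') \<otimes> (w \<otimes> b')" using z w ann c by (simp add: annihilator_mult)
  also have "\<dots> = z \<otimes> (a' \<otimes> w) \<otimes> b'" using zc c by (simp add: m_assoc)
  also have "a' \<otimes> w = w \<otimes> a'" using ann c by (simp add: annihilator_mult annihilator_mult_left)
  also have "z \<otimes> (w \<otimes> a') \<otimes> b' = z \<otimes> (w \<otimes> (a' \<otimes> b'))" using zc c by (simp add: m_assoc)
  also have "\<dots> = z \<oplus> w \<oplus> (a' \<otimes> b')" using ann zc c by (simp add: annihilator_mult add.m_assoc)
  finally have "a \<otimes> b \<oplus> \<ominus> (a' \<otimes> b') = z \<oplus> w" using zc c by (simp add: add.m_assoc)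
  then have "a \<otimes> b \<oplus> \<ominus> (a' \<otimes> b') \<in> Z" using z w subgroup.m_closed[OF Z] by simp
  then show ?thesis unfolding a_r_coset_def
    using add.r_coset_eqI[OF Z, of "a \<otimes> b" "a' \<otimes> b'"] c by simp
qed

end

section \<open>Homomorphic images and quotients\<close>

lemma add_monoid_hom:
  assumes "h \<in> ring_hom R S" shows "h \<in> hom (add_monoid R) (add_monoid S)"
  using assms by (auto simp: hom_def ring_hom_def)

lemma mult_monoid_hom:
  assumes "h \<in> ring_hom R S" shows "h \<in> hom R S"
  using assms by (auto simp: hom_def ring_hom_def)

context skew_brace begin

lemma surj_hom_skew_brace:
  assumes h: "h \<in> ring_hom B C" and surj: "h ` carrier B = carrier C" and zero: "h \<zero> = \<zero>\<^bsub>C\<^esub>"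
  shows "skew_brace C"
proof -
  have "group (C\<lparr>carrier := h ` carrier B, one := h \<one>\<rparr>)"
    by (rule hom_imp_img_group[OF mult_monoid_hom[OF h]])
  then interpret C: group C using h by (simp add: surj ring_hom_def)
  have "group ((add_monoid C)\<lparr>carrier := h ` carrier B, one := h \<zero>\<rparr>)"
    by (rule add.hom_imp_img_group[OF add_monoid_hom[OF h]])
  then interpret CA: group "add_monoid C" by (simp add: surj zero)
  interpret h: group_hom "add_monoid B" "add_monoid C" h
    using add_monoid_hom[OF h] by unfold_locales
  have minus: "h (\<ominus> a) = \<ominus>\<^bsub>C\<^esub> h a" if "a \<in> carrier B" for a
    using h.hom_inv[of a] that by (simp add: a_inv_def)
  show ?thesis
  proof (intro skew_brace.intro skew_brace_axioms.intro)
    show "group C" by (rule C.is_group)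
    show "group (add_monoid C)" by (rule CA.is_group)
    fix x y z assume "x \<in> carrier C" "y \<in> carrier C" "z \<in> carrier C"
    then obtain a b c where abc: "a \<in> carrier B" "b \<in> carrier B" "c \<in> carrier B"
      "x = h a" "y = h b" "z = h c"
      unfolding surj[symmetric] by blast
    have "h (a \<otimes> (b \<oplus> c)) = h (a \<otimes> b \<ominus> a \<oplus> a \<otimes> c)" using abc by (simp add: brace_distrib)
    then show "x \<otimes>\<^bsub>C\<^esub> (y \<oplus>\<^bsub>C\<^esub> z) = x \<otimes>\<^bsub>C\<^esub> y \<ominus>\<^bsub>C\<^esub> x \<oplus>\<^bsub>C\<^esub> x \<otimes>\<^bsub>C\<^esub> z"
      using abc by (simp add: ring_hom_mult[OF h] ring_hom_add[OF h] minus a_minus_def)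
  qed
qed

lemma surj_hom_property_S:
  assumes h: "h \<in> ring_hom B C" and surj: "h ` carrier B = carrier C"
    and C: "skew_brace C" and S: "property_S B"
  shows "property_S C"
proof -
  interpret C: skew_brace C by (rule C)
  interpret ha: group_hom "add_monoid B" "add_monoid C" h
    using add_monoid_hom[OF h] by unfold_locales
  interpret hm: group_hom B C h
    using mult_monoid_hom[OF h] by unfold_locales
  have minus: "h (\<ominus> a) = \<ominus>\<^bsub>C\<^esub> h a" if "a \<in> carrier B" for a
    using ha.hom_inv[of a] that by (simp add: a_inv_def)
  have lam: "h (\<Lambda> a b) = brace_lambda C (h a) (h b)" if "a \<in> carrier B" "b \<in> carrier B" for a b
    using that by (simp add: brace_lambda_def ring_hom_mult[OF h] ring_hom_add[OF h] minus)
  have "finite (rcosets\<^bsub>add_monoid C\<^esub> (C.right_stabiliser (h x)))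
      \<and> finite (rcosets\<^bsub>C\<^esub> (C.left_stabiliser (h x)))" if x: "x \<in> carrier B" for x
  proof
    have hx: "h x \<in> carrier C" using x surj by blast
    have "h ` right_stabiliser x \<subseteq> C.right_stabiliser (h x)"
    proof
      fix c assume "c \<in> h ` right_stabiliser x"
      then obtain b where b: "c = h b" "b \<in> carrier B" "\<Lambda> x b = b" "b \<oplus> x = x \<oplus> b"
        using x by (auto simp: right_stabiliser_iff)
      then show "c \<in> C.right_stabiliser (h x)"
        using lam[OF x b(2)] ring_hom_add[OF h b(2) x] ring_hom_add[OF h x b(2)] hx surj
        by (auto simp: C.right_stabiliser_iff)
    qed
    then show "finite (rcosets\<^bsub>add_monoid C\<^esub> (C.right_stabiliser (h x)))"
      using add.surj_hom_finite_index[OF ha.group_hom_axioms _ right_stabiliser_subgroup[OF x]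
        C.right_stabiliser_subgroup[OF hx] _ property_S_stabilisers(1)[OF S x]] surj by simp
    have "h ` left_stabiliser x \<subseteq> C.left_stabiliser (h x)"
    proof
      fix c assume "c \<in> h ` left_stabiliser x"
      then obtain b where b: "c = h b" "b \<in> carrier B" "\<Lambda> b x = x" "b \<otimes> x = x \<otimes> b"
        using x by (auto simp: left_stabiliser_iff)
      then show "c \<in> C.left_stabiliser (h x)"
        using lam[OF b(2) x] ring_hom_mult[OF h b(2) x] ring_hom_mult[OF h x b(2)] hx surj
        by (auto simp: C.left_stabiliser_iff)
    qed
    then show "finite (rcosets\<^bsub>C\<^esub> (C.left_stabiliser (h x)))"
      using surj_hom_finite_index[OF hm.group_hom_axioms surj left_stabiliser_subgroup[OF x]
        C.left_stabiliser_subgroup[OF hx] _ property_S_stabilisers(2)[OF S x]] by simp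
  qed
  note stabilisers = this
  show ?thesis
    unfolding property_S_def
  proof
    fix y assume "y \<in> carrier C"
    then obtain x where "x \<in> carrier B" "y = h x" unfolding surj[symmetric] by blast
    then show "property_s C y"
      using stabilisers[of x]
      by (simp add: property_s_def C.right_stabiliser_def C.left_stabiliser_def)
  qed
qed

text \<open>
  The quotient construction of the library for rings makes sense for the record of operations alone.
  Compatibility of \<open>\<otimes>\<close> with the additive cosets replaces the ideal laws: it makes all sets in the union
  that defines the product of two cosets equal.
\<close>

lemma quotient_by_congruence:
  assumes I: "I \<lhd> add_monoid B"
    and cong: "\<And>a a' b b'. \<lbrakk>a \<in> carrier B; a' \<in> carrier B; b \<in> carrier B; b' \<in> carrier B;
      I +> a = I +> a'; I +> b = I +> b'\<rbrakk> \<Longrightarrow> I +> (a \<otimes> b) = I +> (a' \<otimes> b')"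
  shows "(+>) I \<in> ring_hom B (B Quot I)"
    and "(+>) I ` carrier B = carrier (B Quot I)"
    and "skew_brace (B Quot I)"
proof -
  interpret I: normal I "add_monoid B" by (rule I)
  have sub: "I \<subseteq> carrier B" using I.subset by simp
  have coset: "I +> x = I +> a" if "x \<in> I +> a" "a \<in> carrier B" for x a
    using add.repr_independence[of x I a] that I.subgroup_axioms by (simp add: a_r_coset_def)
  have mem: "a \<in> I +> a" if "a \<in> carrier B" for a
    using add.rcos_self[OF that I.subgroup_axioms] by (simp add: a_r_coset_def)
  have closed: "x \<in> carrier B" if "x \<in> I +> a" "a \<in> carrier B" for x a
    using that sub by (auto simp: a_r_coset_def r_coset_def)
  have mult: "rcoset_mult B I (I +> a) (I +> b) = I +> (a \<otimes> b)"
    if "a \<in> carrier B" "b \<in> carrier B" for a b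
  proof -
    have "I +> (x \<otimes> y) = I +> (a \<otimes> b)" if xy: "x \<in> I +> a" "y \<in> I +> b" for x y
      using cong[OF closed[OF xy(1)] _ closed[OF xy(2)] _ coset[OF xy(1)] coset[OF xy(2)]]
        \<open>a \<in> carrier B\<close> \<open>b \<in> carrier B\<close> by blast
    then show ?thesis
      unfolding rcoset_mult_def using mem that by blast
  qed
  have add: "set_add B (I +> a) (I +> b) = I +> (a \<oplus> b)"
    if "a \<in> carrier B" "b \<in> carrier B" for a b
    using I.rcos_sum[of a b] that by (simp add: set_add_def a_r_coset_def)
  show surj: "(+>) I ` carrier B = carrier (B Quot I)"
    by (auto simp: FactRing_def A_RCOSETS_def RCOSETS_def a_r_coset_def)
  show hom: "(+>) I \<in> ring_hom B (B Quot I)"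
  proof (rule ring_hom_memI)
    show "I +> x \<in> carrier (B Quot I)" if "x \<in> carrier B" for x using that surj by blast
  qed (simp_all add: FactRing_def mult add)
  have "I +> \<zero> = I" using add.coset_mult_one[OF sub] by (simp add: a_r_coset_def)
  then show "skew_brace (B Quot I)"
    using surj_hom_skew_brace[OF hom surj] by (simp add: FactRing_def)
qed

section \<open>The subdirect decomposition\<close>

text \<open>
  Such a subgroup exists by Zorn's lemma. If no positive multiple of an element \<open>x\<close> of the annihilator
  were in \<open>Z\<close>, then \<open>Z\<close> could be enlarged by the multiples of \<open>x\<close>: a torsion element \<open>z \<oplus> h\<close>, with \<open>h\<close> a
  multiple of \<open>x\<close> or its negative, has \<open>[N] \<cdot> h \<in> Z\<close> for some positive \<open>N\<close>, which forces \<open>h = \<zero>\<close>.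
\<close>

lemma maximal_torsion_free_annihilating_subgroup:
  obtains Z where "subgroup Z (add_monoid B)" "Z \<subseteq> annihilator" "Z \<inter> torsion_part = {\<zero>}"
    "\<forall>x\<in>annihilator. \<exists>n::nat. n > 0 \<and> [n] \<cdot> x \<in> Z"
proof -
  define F where "F = {Z. subgroup Z (add_monoid B) \<and> Z \<subseteq> annihilator \<and> Z \<inter> torsion_part = {\<zero>}}"
  have zero_torsion: "\<zero> \<in> torsion_part" by (auto simp: torsion_part_iff intro: exI[of _ 1])
  have zero_ann: "\<zero> \<in> annihilator" using subgroup.one_closed[OF annihilator_subgroup] by simp
  have "{\<zero>} \<in> F"
    using add.triv_subgroup zero_torsion zero_ann by (auto simp: F_def)
  moreover have "\<Union>\<C> \<in> F" if ne: "\<C> \<noteq> {}" and chain: "subset.chain F \<C>" for \<C>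
  proof -
    have CF: "\<C> \<subseteq> F" using chain by (auto simp: subset.chain_def)
    have zero: "\<zero> \<in> Z" if "Z \<in> \<C>" for Z
      using that CF subgroup.one_closed[of Z "add_monoid B"] by (auto simp: F_def)
    have "subgroup (\<Union>\<C>) (add_monoid B)"
    proof (rule add.subgroupI)
      show "\<Union>\<C> \<subseteq> carrier B" using CF annihilator_closed by (auto simp: F_def)
      show "\<Union>\<C> \<noteq> {}" using ne zero by blast
      fix a assume "a \<in> \<Union>\<C>"
      then obtain W where W: "W \<in> \<C>" "a \<in> W" by blast
      have sP: "subgroup W (add_monoid B)" using W CF by (auto simp: F_def)
      show "\<ominus> a \<in> \<Union>\<C>" using subgroup.m_inv_closed[OF sP W(2)] W(1) by (auto simp: a_inv_def)
      fix b assume "b \<in> \<Union>\<C>"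
      then obtain Q where Q: "Q \<in> \<C>" "b \<in> Q" by blast
      have sQ: "subgroup Q (add_monoid B)" using Q CF by (auto simp: F_def)
      have "W \<subseteq> Q \<or> Q \<subseteq> W" using chain W Q by (auto simp: subset.chain_def)
      then show "a \<oplus> b \<in> \<Union>\<C>"
        using subgroup.m_closed[OF sP, of a b] subgroup.m_closed[OF sQ, of a b] W Q by auto
    qed
    moreover have "\<Union>\<C> \<inter> torsion_part = {\<zero>}"
      using CF ne zero zero_torsion by (auto simp: F_def)
    ultimately show ?thesis using CF by (auto simp: F_def)
  qed
  ultimately obtain Z where Z: "Z \<in> F" and max: "\<And>W. W \<in> F \<Longrightarrow> Z \<subseteq> W \<Longrightarrow> W = Z"
    using subset_Zorn_nonempty[of F] by blast
  have sub: "subgroup Z (add_monoid B)" and ann: "Z \<subseteq> annihilator" and tf: "Z \<inter> torsion_part = {\<zero>}"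
    using Z by (auto simp: F_def)
  have multiple: "\<exists>n::nat. n > 0 \<and> [n] \<cdot> x \<in> Z" if x: "x \<in> annihilator" for x
  proof -
    note xc = annihilator_closed[OF x]
    show ?thesis
    proof (rule ccontr)
      assume "\<not> ?thesis"
      then have no: "\<not> n > 0" if "[n] \<cdot> x \<in> Z" for n :: nat using that by auto
      define H where "H = generate (add_monoid B) {x}"
      have subH: "subgroup H (add_monoid B)"
        unfolding H_def using xc by (intro add.generate_is_subgroup) simp
      have xH: "x \<in> H" unfolding H_def by (intro generate.incl) simp
      have H_ann: "H \<subseteq> annihilator"
        unfolding H_def using x annihilator_subgroup by (intro add.generate_subgroup_incl) simp_all
      have multiple: "\<exists>k::nat. h = [k] \<cdot> x \<or> h = \<ominus> ([k] \<cdot> x)" if h: "h \<in> H" for h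
      proof -
        obtain i :: int where i: "h = [i] \<cdot> x"
          using h add.generate_pow[OF xc] by (auto simp: H_def)
        show ?thesis
        proof (cases i rule: int_cases2)
          case (nonneg n)
          then have "h = [n] \<cdot> x" using i int_pow_int[of "add_monoid B" x n] by (simp add: add_pow_def)
          then show ?thesis by blast
        next
          case (nonpos n)
          then have "h = \<ominus> ([n] \<cdot> x)" using i add.int_pow_neg_int[OF xc, of n] by simp
          then show ?thesis by blast
        qed
      qed
      define W where "W = Z <#>\<^bsub>add_monoid B\<^esub> H"
      have W_iff: "y \<in> W \<longleftrightarrow> (\<exists>z\<in>Z. \<exists>h\<in>H. y = z \<oplus> h)" for y
        by (auto simp: W_def set_mult_def)
      have subW: "subgroup W (add_monoid B)"
        unfolding W_def
        by (rule add.mult_norm_subgroup[OF subgroup_of_annihilator_normal[OF sub ann] subH])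
      have W_ann: "W \<subseteq> annihilator"
      proof
        fix y assume "y \<in> W"
        then obtain z h where zh: "z \<in> Z" "h \<in> H" "y = z \<oplus> h" unfolding W_iff by blast
        then have "z \<in> annihilator" "h \<in> annihilator" using ann H_ann by blast+
        then show "y \<in> annihilator"
          using subgroup.m_closed[OF annihilator_subgroup, of z h] zh(3) by simp
      qed
      have "y = \<zero>" if y: "y \<in> W" "y \<in> torsion_part" for y
      proof -
        obtain z h where zh: "z \<in> Z" "h \<in> H" "y = z \<oplus> h" using y(1) W_iff by blast
        have zc: "z \<in> carrier B" and hc: "h \<in> carrier B"
          using zh ann H_ann annihilator_closed by auto
        obtain N :: nat where N: "N > 0" "[N] \<cdot> y = \<zero>" using y(2) by (auto simp: torsion_part_iff)
        have "z \<oplus> h = h \<oplus> z" using annihilator_commute[of z h] zh(1) ann hc by blast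
        then have "[N] \<cdot> z \<oplus> [N] \<cdot> h = \<zero>"
          using add.pow_mult_distrib[of z h N] N zh(3) zc hc by simp
        then have "[N] \<cdot> h = \<ominus> ([N] \<cdot> z)" using zc hc by (metis add.inv_equality add.inv_inv add.nat_pow_closed)
        moreover have "[N] \<cdot> z \<in> Z" using add.subgroup_nat_pow_mem[OF sub zh(1)] .
        ultimately have Nh: "[N] \<cdot> h \<in> Z" using subgroup.m_inv_closed[OF sub] by (simp add: a_inv_def)
        obtain k :: nat where k: "h = [k] \<cdot> x \<or> h = \<ominus> ([k] \<cdot> x)" using multiple[OF zh(2)] by blast
        have "[(k * N)] \<cdot> x \<in> Z"
        proof (cases "h = [k] \<cdot> x")
          case True
          then show ?thesis using Nh xc by (simp add: add.nat_pow_pow)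
        next
          case False
          then have "[N] \<cdot> h = \<ominus> ([(k * N)] \<cdot> x)" using k xc by (simp add: add.nat_pow_inv add.nat_pow_pow)
          then have "\<ominus> ([N] \<cdot> h) = [(k * N)] \<cdot> x" using xc by simp
          then show ?thesis using subgroup.m_inv_closed[OF sub Nh] by (simp add: a_inv_def)
        qed
        then have "\<not> k * N > 0" by (rule no)
        then have "k = 0" using N(1) by simp
        then have "h = \<zero>" using k by auto
        then have "y = z" using zh zc by simp
        then show ?thesis using tf y(2) zh(1) by blast
      qed
      then have "W \<inter> torsion_part = {\<zero>}"
        using subgroup.one_closed[OF subW] zero_torsion by auto
      then have "W \<in> F" using subW W_ann by (simp add: F_def)
      moreover have "Z \<subseteq> W"
      proof
        fix z assume "z \<in> Z"
        moreover have "\<zero> \<in> H" using subgroup.one_closed[OF subH] by simp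
        moreover have "z \<in> carrier B" using \<open>z \<in> Z\<close> ann annihilator_closed by blast
        then have "z = z \<oplus> \<zero>" by simp
        ultimately show "z \<in> W" unfolding W_iff by blast
      qed
      ultimately have "W = Z" by (rule max)
      moreover have "x \<in> W"
      proof -
        have "\<zero> \<in> Z" using subgroup.one_closed[OF sub] by simp
        moreover have "x = \<zero> \<oplus> x" using xc by simp
        ultimately show ?thesis using xH unfolding W_iff by blast
      qed
      ultimately have "[(1::nat)] \<cdot> x \<in> Z" using xc by simp
      then have "\<not> (1::nat) > 0" by (rule no)
      then show False by simp
    qed
  qed
  show ?thesis by (rule that[OF sub ann tf]) (use multiple in blast)
qed

end

lemma RDirProd_is_group:
  assumes "group C" "group D" shows "group (RDirProd C D)"
proof -
  interpret C: group C by fact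
  interpret D: group D by fact
  show ?thesis
  proof (rule groupI)
    fix p assume "p \<in> carrier (RDirProd C D)"
    then obtain x y where p: "p = (x, y)" "x \<in> carrier C" "y \<in> carrier D"
      by (auto simp: RDirProd_carrier)
    then show "\<exists>q\<in>carrier (RDirProd C D). q \<otimes>\<^bsub>RDirProd C D\<^esub> p = \<one>\<^bsub>RDirProd C D\<^esub>"
      by (intro bexI[of _ "(inv\<^bsub>C\<^esub> x, inv\<^bsub>D\<^esub> y)"]) (auto simp: RDirProd_def DirProd_def monoid.defs)
  qed (auto simp: RDirProd_def DirProd_def monoid.defs C.m_assoc D.m_assoc)
qed

lemma subdirect_productI:
  fixes B :: "('a, 'm) ring_scheme" and C :: "('b, 'n) ring_scheme" and D :: "('c, 'k) ring_scheme"
  assumes B: "skew_brace B" and C: "skew_brace C" and D: "skew_brace D"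
    and h: "h \<in> ring_hom B C" "h ` carrier B = carrier C"
    and g: "g \<in> ring_hom B D" "g ` carrier B = carrier D"
    and inj: "\<And>a b. \<lbrakk>a \<in> carrier B; b \<in> carrier B; h a = h b; g a = g b\<rbrakk> \<Longrightarrow> a = b"
  shows "subdirect_product B C D"
proof -
  interpret B: skew_brace B by (rule B)
  interpret C: skew_brace C by (rule C)
  interpret D: skew_brace D by (rule D)
  let ?P = "RDirProd C D"
  define \<phi> where "\<phi> b = (h b, g b)" for b
  have \<phi>: "\<phi> \<in> ring_hom B ?P"
    using h(1) g(1) by (auto simp: ring_hom_def \<phi>_def RDirProd_def DirProd_def monoid.defs)
  interpret P: group ?P by (rule RDirProd_is_group[OF C.is_group D.is_group])
  interpret PA: group "add_monoid ?P"
    unfolding RDirProd_add_monoid by (rule DirProd_group[OF C.add_group D.add_group])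
  interpret ha: group_hom "add_monoid B" "add_monoid ?P" \<phi>
    using add_monoid_hom[OF \<phi>] B.add_group PA.is_group
    by (simp only: group_hom_def group_hom_axioms_def)
  interpret hm: group_hom B ?P \<phi>
    using mult_monoid_hom[OF \<phi>] by unfold_locales
  let ?S = "\<phi> ` carrier B"
  have "sub_skew_brace ?S ?P"
    using ha.img_is_subgroup hm.img_is_subgroup by (simp add: sub_skew_brace_def)
  moreover have "fst ` ?S = carrier C" "snd ` ?S = carrier D"
    using h(2) g(2) by (simp_all add: image_image \<phi>_def)
  moreover have "\<phi> \<in> ring_iso B (?P\<lparr>carrier := ?S\<rparr>)"
  proof -
    have "\<phi> \<in> ring_hom B (?P\<lparr>carrier := ?S\<rparr>)"
      using \<phi> by (auto simp: ring_hom_def)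
    moreover have "inj_on \<phi> (carrier B)"
      by (rule inj_onI) (auto simp: \<phi>_def intro: inj)
    ultimately show ?thesis by (simp add: ring_iso_def bij_betw_def)
  qed
  ultimately show ?thesis
    unfolding subdirect_product_def is_ring_iso_def by blast
qed

text \<open>
  The quotient by the torsion part is trivial, because there \<open>\<otimes>\<close> becomes \<open>\<oplus>\<close> and commutators vanish. In
  the quotient by \<open>Z\<close> every element has finite order: a multiple of it comes from the annihilator, and a
  further multiple from \<open>Z\<close>.
\<close>

lemma (in skew_brace) subdirect_decomposition:
  assumes S: "property_S B"
  shows "\<exists>(C :: 'a set ring) (D :: 'a set ring).
    trivial_brace C \<and> periodic_skew_brace D \<and> subdirect_product B C D \<and>
    homomorphic_image C B \<and> homomorphic_image D B"
proof -
  let ?T = "torsion_part"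
  obtain Z where Z: "subgroup Z (add_monoid B)" "Z \<subseteq> annihilator" "Z \<inter> ?T = {\<zero>}"
    and Z_max: "\<forall>x\<in>annihilator. \<exists>n::nat. n > 0 \<and> [n] \<cdot> x \<in> Z"
    by (rule maximal_torsion_free_annihilating_subgroup)
  let ?C = "B Quot ?T" and ?D = "B Quot Z"
  have T: "?T \<lhd> add_monoid B" by (rule torsion_part_normal[OF S])
  have ZN: "Z \<lhd> add_monoid B" by (rule subgroup_of_annihilator_normal[OF Z(1,2)])

  have T_cong: "?T +> (a \<otimes> b) = ?T +> (a' \<otimes> b')"
    if "a \<in> carrier B" "a' \<in> carrier B" "b \<in> carrier B" "b' \<in> carrier B"
      "?T +> a = ?T +> a'" "?T +> b = ?T +> b'" for a a' b b'
    using that torsion_coset_mult[OF S] normal.rcos_sum[OF T, of a b] normal.rcos_sum[OF T, of a' b']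
    by (simp add: a_r_coset_def)
  have C_hom: "(+>) ?T \<in> ring_hom B ?C"
    and C_surj: "(+>) ?T ` carrier B = carrier ?C" and C_brace: "skew_brace ?C"
    by (rule quotient_by_congruence[OF T T_cong]; assumption)+
  have D_hom: "(+>) Z \<in> ring_hom B ?D"
    and D_surj: "(+>) Z ` carrier B = carrier ?D" and D_brace: "skew_brace ?D"
    by (rule quotient_by_congruence[OF ZN annihilator_coset_mult_cong[OF Z(1,2)]]; assumption)+

  have C_rep: "\<exists>a\<in>carrier B. x = ?T +> a" if "x \<in> carrier ?C" for x
    using that unfolding C_surj[symmetric] by blast
  interpret C: skew_brace ?C by (rule C_brace)
  have "comm_group (add_monoid ?C)"
  proof (rule group.group_comm_groupI[OF C.add_group])
    fix x y assume "x \<in> carrier (add_monoid ?C)" "y \<in> carrier (add_monoid ?C)"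
    then obtain a b where "a \<in> carrier B" "b \<in> carrier B" "x = ?T +> a" "y = ?T +> b"
      using C_rep[of x] C_rep[of y] by auto
    then show "x \<otimes>\<^bsub>add_monoid ?C\<^esub> y = y \<otimes>\<^bsub>add_monoid ?C\<^esub> x"
      using ring_hom_add[OF C_hom, of a b] ring_hom_add[OF C_hom, of b a]
        torsion_coset_add_commute[OF S, of a b] by simp
  qed
  moreover have "x \<otimes>\<^bsub>?C\<^esub> y = x \<oplus>\<^bsub>?C\<^esub> y" if xy: "x \<in> carrier ?C" "y \<in> carrier ?C" for x y
  proof -
    obtain a b where "a \<in> carrier B" "b \<in> carrier B" "x = ?T +> a" "y = ?T +> b"
      using C_rep[OF xy(1)] C_rep[OF xy(2)] by blast
    then show ?thesis
      using ring_hom_add[OF C_hom, of a b] ring_hom_mult[OF C_hom, of a b]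
        torsion_coset_mult[OF S, of a b] by simp
  qed
  ultimately have C: "trivial_brace ?C" using C_brace by (simp add: trivial_brace_def)

  have "\<exists>n::nat. n > 0 \<and> [n] \<cdot>\<^bsub>?D\<^esub> x = \<zero>\<^bsub>?D\<^esub>" if "x \<in> carrier ?D" for x
  proof -
    interpret D: skew_brace ?D by (rule D_brace)
    interpret hd: group_hom "add_monoid B" "add_monoid ?D" "(+>) Z"
      using add_monoid_hom[OF D_hom] add_group D.add_group
      by (simp only: group_hom_def group_hom_axioms_def)
    obtain a where a: "a \<in> carrier B" "x = Z +> a"
      using \<open>x \<in> carrier ?D\<close> unfolding D_surj[symmetric] by blast
    obtain n :: nat where n: "n > 0" "[n] \<cdot> a \<in> annihilator" by (rule multiple_in_annihilator[OF S a(1)])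
    obtain m :: nat where m: "m > 0" "[m] \<cdot> ([n] \<cdot> a) \<in> Z" using Z_max n(2) by blast
    have "[(n * m)] \<cdot> a \<in> Z" using m(2) a by (simp add: add.nat_pow_pow)
    then have "Z +> ([(n * m)] \<cdot> a) = Z"
      using add.coset_join2[of "[(n * m)] \<cdot> a" Z] Z(1) a by (simp add: a_r_coset_def)
    then have "[(n * m)] \<cdot>\<^bsub>?D\<^esub> x = \<zero>\<^bsub>?D\<^esub>"
      using hd.hom_nat_pow[of a "n * m"] a by (simp add: add_pow_def FactRing_def)
    then show ?thesis using n(1) m(1) by (intro exI[of _ "n * m"]) simp
  qed
  then have D: "periodic_skew_brace ?D"
    using D_brace surj_hom_property_S[OF D_hom D_surj D_brace S] by (simp add: periodic_skew_brace_def)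

  have "subdirect_product B ?C ?D"
  proof (rule subdirect_productI[OF skew_brace_axioms C_brace D_brace C_hom C_surj D_hom D_surj])
    fix a b assume ab: "a \<in> carrier B" "b \<in> carrier B" "?T +> a = ?T +> b" "Z +> a = Z +> b"
    have "a \<oplus> \<ominus> b \<in> ?T" "a \<oplus> \<ominus> b \<in> Z"
      using add.r_coset_eqD[of _ a b] Z(1) normal.axioms(1)[OF T] ab by (auto simp: a_r_coset_def)
    then have "a \<oplus> \<ominus> b = \<zero>" using Z(3) by blast
    then show "a = b" using ab by (simp add: add.inv_solve_right')
  qed
  moreover have "homomorphic_image ?C B" "homomorphic_image ?D B"
    unfolding homomorphic_image_def using C_hom C_surj D_hom D_surj by blast+
  ultimately show ?thesis using C D by blast
qed

theorem theorem3p27: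
  fixes B :: "('a, 'm) ring_scheme"
  assumes "skew_brace B" and "property_S B"
  shows "\<exists>(C :: 'a set ring) (D :: 'a set ring).
    trivial_brace C \<and> periodic_skew_brace D \<and> subdirect_product B C D \<and>
    homomorphic_image C B \<and> homomorphic_image D B"
  using assms by (rule skew_brace.subdirect_decomposition)

end
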